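(* For every integer $m\ge 1$, let $G=\mathbb{K}[C_5](m,m,m,m,m)$ be the complete expansion of the 5-cycle $C_5$ in which every vertex is replaced by a copy of $K_m$. Then $G$ is $\{P_3\cup P_2,\ \mathrm{gem}\}$-free, $\omega(G)=2m$ and $\chi(G)=\left\lceil \frac{5\,\omega(G)}{4}\right\rceil$. Hence the optimal $\chi$-binding function $f^*$ for the class of $\{P_3\cup P_2,\ \mathrm{gem}\}$-free graphs satisfies $f^*\ge \left\lceil \frac{5\omega(G)}{4}\right\rceil$, and the class of $\{P_3\cup P_2,\ \mathrm{gem}\}$-free graphs cannot have a special linear $\chi$-binding function.
   Context: All graphs are finite, simple and undirected. $\chi(G)$ is the chromatic number and $\omega(G)$ the clique number of $G$. $P_n$, $C_n$, $K_n$ are the path, cycle and complete graph on $n$ vertices. $P_3\cup P_2$ is the disjoint union of $P_3$ and $P_2$. The gem is the join $K_1+P_4$ (a $P_4$ together with one extra vertex adjacent to all four vertices of the path). For a family $\mathcal{F}$ of graphs, $G$ is $\mathcal{F}$-free if no induced subgraph of $G$ is isomorphic to a member of $\mathcal{F}$. Given a graph $G$ with vertices $v_1,\dots,v_n$ and positive integers $m_1,\dots,m_n$, the complete expansion $\mathbb{K}[G](m_1,\dots,m_n)$ is the graph obtained from $G$ by replacing each $v_i$ by a complete graph $H_i\cong K_{m_i}$ (the $H_i$ pairwise vertex-disjoint) and joining every vertex of $H_i$ to every vertex of $H_j$ whenever $v_i$ and $v_j$ are adjacent in $G$ (with no other edges). A $\chi$-binding function for a hereditary class $\mathcal{G}$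 of graphs is a function $f$ with $\chi(G)\le f(\omega(G))$ for all $G\in\mathcal{G}$; it is special linear if $f(x)=x+c$, where $c$ is a constant. $f^*$ denotes the optimal (smallest) $\chi$-binding function of the class, regarded as a function of the clique number. *)

theory Defs
  imports Complex_Main "Graph_Theory.Graph_Theory"
begin

text \<open>
  A finite simple undirected graph is a pair digraph satisfying the locale \<^locale>\<open>pair_graph\<close>: finite,
  loop-free and symmetric, an edge between u and v being the two arcs (u,v) and (v,u).
  The null graph is allowed.
\<close>

section \<open>Basic graphs and constructions\<close>

definition complete_graph :: "nat \<Rightarrow> nat pair_pre_digraph" where
  "complete_graph n = \<lparr>pverts = {..<n}, parcs = {(i, j). i < n \<and> j < n \<and> i \<noteq> j}\<rparr>"

definition path_graph :: "nat \<Rightarrow> nat pair_pre_digraph" where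
  "path_graph n =
    \<lparr>pverts = {..<n}, parcs = {(i, j). i < n \<and> j < n \<and> (j = Suc i \<or> i = Suc j)}\<rparr>"

text \<open>The cycle on n vertices, meaningful for n at least 3.\<close>

definition cycle_graph :: "nat \<Rightarrow> nat pair_pre_digraph" where
  "cycle_graph n =
    \<lparr>pverts = {..<n},
     parcs = {(i, j). i < n \<and> j < n \<and> (j = Suc i mod n \<or> i = Suc j mod n)}\<rparr>"

definition disjoint_union ::
    "'a pair_pre_digraph \<Rightarrow> 'b pair_pre_digraph \<Rightarrow> ('a + 'b) pair_pre_digraph" where
  "disjoint_union G H =
    \<lparr>pverts = pverts G <+> pverts H,
     parcs = map_prod Inl Inl ` parcs G \<union> map_prod Inr Inr ` parcs H\<rparr>"

definition graph_join ::
    "'a pair_pre_digraph \<Rightarrow> 'b pair_pre_digraph \<Rightarrow> ('a + 'b) pair_pre_digraph" where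
  "graph_join G H =
    \<lparr>pverts = pverts G <+> pverts H,
     parcs = map_prod Inl Inl ` parcs G \<union> map_prod Inr Inr ` parcs H
       \<union> (Inl ` pverts G) \<times> (Inr ` pverts H) \<union> (Inr ` pverts H) \<times> (Inl ` pverts G)\<rparr>"

definition P3_union_P2 :: "(nat + nat) pair_pre_digraph" where
  "P3_union_P2 = disjoint_union (path_graph 3) (path_graph 2)"

definition gem :: "(nat + nat) pair_pre_digraph" where
  "gem = graph_join (complete_graph 1) (path_graph 4)"

text \<open>
  The multiplicities are a function on the vertices; vertex v is replaced by the clique of the
  pairs (v,i) with i below its multiplicity.
\<close>

definition complete_expansion ::
    "'a pair_pre_digraph \<Rightarrow> ('a \<Rightarrow> nat) \<Rightarrow> ('a \<times> nat) pair_pre_digraph" where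
  "complete_expansion G m =
    \<lparr>pverts = (SIGMA v:pverts G. {..<m v}),
     parcs = {((u, i), (v, j)). u \<in> pverts G \<and> i < m u \<and> v \<in> pverts G \<and> j < m v
       \<and> (u = v \<and> i \<noteq> j \<or> (u, v) \<in> parcs G)}\<rparr>"

section \<open>Clique number, chromatic number, forbidden induced subgraphs\<close>

definition graph_clique :: "'a pair_pre_digraph \<Rightarrow> 'a set \<Rightarrow> bool" where
  "graph_clique G S \<longleftrightarrow> S \<subseteq> pverts G \<and> (\<forall>u\<in>S. \<forall>v\<in>S. u \<noteq> v \<longrightarrow> (u, v) \<in> parcs G)"

definition clique_number :: "'a pair_pre_digraph \<Rightarrow> nat" where
  "clique_number G = Max (card ` {S. graph_clique G S})"

definition proper_colouring :: "'a pair_pre_digraph \<Rightarrow> nat \<Rightarrow> ('a \<Rightarrow> nat) \<Rightarrow> bool" where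
  "proper_colouring G k c \<longleftrightarrow>
    (\<forall>v\<in>pverts G. c v < k) \<and> (\<forall>(u, v)\<in>parcs G. c u \<noteq> c v)"

definition chromatic_number :: "'a pair_pre_digraph \<Rightarrow> nat" where
  "chromatic_number G = (LEAST k. \<exists>c. proper_colouring G k c)"

definition free_graphs :: "'b pair_pre_digraph set \<Rightarrow> 'a pair_pre_digraph set" where
  "free_graphs \<F> =
    {G. pair_graph G \<and>
      \<not> (\<exists>K H. induced_subgraph K (with_proj G) \<and> H \<in> \<F> \<and> digraph_iso K (with_proj H))}"

section \<open>Chi-binding functions\<close>

text \<open>
  Quantifying over the members of a class of graphs requires a fixed vertex type. For an
  isomorphism-closed class of finite graphs, nat as vertex type loses nothing.
\<close>

definition chi_binding :: "'a pair_pre_digraph set \<Rightarrow> (nat \<Rightarrow> real) \<Rightarrow> bool" where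
  "chi_binding \<G> f \<longleftrightarrow> (\<forall>G\<in>\<G>. real (chromatic_number G) \<le> f (clique_number G))"

definition optimal_chi_binding :: "'a pair_pre_digraph set \<Rightarrow> (nat \<Rightarrow> real) \<Rightarrow> bool" where
  "optimal_chi_binding \<G> f \<longleftrightarrow>
    chi_binding \<G> f \<and> (\<forall>g. chi_binding \<G> g \<longrightarrow> (\<forall>x. f x \<le> g x))"

definition special_linear :: "(nat \<Rightarrow> real) \<Rightarrow> bool" where
  "special_linear f \<longleftrightarrow> (\<exists>c. \<forall>x. f x = real x + c)"

lemma optimal_chi_binding_unique:
  assumes "optimal_chi_binding \<G> f" and "optimal_chi_binding \<G> g"
  shows "f = g"
  using assms by (auto simp: optimal_chi_binding_def fun_eq_iff intro: antisym)

section \<open>The constructions yield graphs\<close>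

lemma pair_graphI:
  assumes "finite (pverts G)"
    and "\<And>u v. (u, v) \<in> parcs G \<Longrightarrow> u \<in> pverts G \<and> v \<in> pverts G \<and> u \<noteq> v \<and> (v, u) \<in> parcs G"
  shows "pair_graph G"
proof -
  have "parcs G \<subseteq> pverts G \<times> pverts G"
    using assms(2) by auto
  then have "finite (parcs G)"
    using assms(1) by (meson finite_SigmaI finite_subset)
  then show ?thesis
    using assms by unfold_locales (auto simp: symmetric_def intro: symI)
qed

lemma pair_graphD:
  assumes "pair_graph G"
  shows "finite (pverts G)"
    and "(u, v) \<in> parcs G \<Longrightarrow> u \<in> pverts G \<and> v \<in> pverts G \<and> u \<noteq> v \<and> (v, u) \<in> parcs G"
proof -
  interpret pair_graph G by fact
  show "finite (pverts G)" by (rule pair_finite_verts)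
  show "u \<in> pverts G \<and> v \<in> pverts G \<and> u \<noteq> v \<and> (v, u) \<in> parcs G" if "(u, v) \<in> parcs G"
    using that in_arcsD1 in_arcsD2 no_loops' arcs_symmetric by blast
qed

lemma complete_graph_complete_digraph: "complete_digraph n (with_proj (complete_graph n))"
  unfolding complete_digraph_pair_def complete_graph_def by auto

lemma pair_graph_complete_graph: "pair_graph (complete_graph n)"
  by (rule pair_graphI) (auto simp: complete_graph_def)

lemma pair_graph_path_graph: "pair_graph (path_graph n)"
  by (rule pair_graphI) (auto simp: path_graph_def)

lemma pair_graph_cycle_graph: "3 \<le> n \<Longrightarrow> pair_graph (cycle_graph n)"
  by (rule pair_graphI) (auto simp: cycle_graph_def mod_Suc split: if_splits)

lemma pair_graph_disjoint_union:
  assumes "pair_graph G" and "pair_graph H"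
  shows "pair_graph (disjoint_union G H)"
  using pair_graphD[OF assms(1)] pair_graphD[OF assms(2)]
  by (intro pair_graphI) (force simp: disjoint_union_def)+

lemma pair_graph_graph_join:
  assumes "pair_graph G" and "pair_graph H"
  shows "pair_graph (graph_join G H)"
  using pair_graphD[OF assms(1)] pair_graphD[OF assms(2)]
  by (intro pair_graphI) (force simp: graph_join_def)+

lemma pair_graph_complete_expansion:
  assumes "pair_graph G"
  shows "pair_graph (complete_expansion G m)"
  using pair_graphD[OF assms]
  by (intro pair_graphI) (auto simp: complete_expansion_def)

end

theory Submission
  imports Defs
begin

text \<open>
  \<^bold>\<open>The expansions of the cycle.\<close> Write \<open>p \<approx> q\<close> when p and q are equal or adjacent in the
  5-cycle. In the expansion, distinct vertices are adjacent iff their positions on the cycle are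
  related by \<open>\<approx>\<close>, so everything reduces to facts about five points. A path on three vertices with
  non-adjacent ends occupies three consecutive positions, and these dominate the cycle: there is no
  room for a disjoint edge (\<open>C5_path_dominating\<close>). In a gem the three path vertices a, c, d would lie
  in the closed neighbourhood of the apex, with c and d not related to a, which forces c and d into
  the same position, although b distinguishes them (\<open>C5_nonneighbour_unique\<close>). The cycle has no
  triangle, so a clique lives in two positions and has at most 2m vertices. The cycle has no
  independent set of size three, so a colour class has at most two of the 5m vertices, and
  \<open>\<lceil>5m/2\<rceil>\<close> colours are needed; they suffice because the positions can be given
  consecutive cyclic intervals of m colours each, running twice around the palette.

  \<^bold>\<open>Existence of the optimal function.\<close> The least binding function sends x to the maximum of \<open>\<chi>\<close>
  over the members of clique number x. This is meaningful only if that set of values is nonempty,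
  which the complete graphs ensure, and bounded, which is the lemma
  \<open>chromatic_number_le_if_P3_union_P2_free\<close>: fix a maximum clique A and sort the vertices by their
  non-neighbours in A. Two common non-neighbours form an edge without neighbours in the class, so the class
  contains no induced \<open>P\<^sub>3\<close> and is a disjoint union of cliques; a class with a single common
  non-neighbour is independent, since otherwise A could be enlarged by an exchange. In both cases
  \<open>\<omega>\<close> colours suffice for each of at most \<open>2\<^sup>\<omega>\<close> classes.

  \<^bold>\<open>No special linear bound.\<close> The expansions give f(2m) at least 5m/2, which exceeds 2m + c as soon
  as m > 2c.
\<close>

section \<open>Forbidden subgraphs as embeddings\<close>

definition induced_copy :: "'b pair_pre_digraph \<Rightarrow> 'a pair_pre_digraph \<Rightarrow> ('b \<Rightarrow> 'a) \<Rightarrow> bool" where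
  "induced_copy H G f \<longleftrightarrow> inj_on f (pverts H) \<and> f ` pverts H \<subseteq> pverts G \<and>
    (\<forall>u\<in>pverts H. \<forall>v\<in>pverts H. (f u, f v) \<in> parcs G \<longleftrightarrow> (u, v) \<in> parcs H)"

lemma induced_copy_if_iso:
  assumes K: "induced_subgraph K (with_proj G)" and iso: "digraph_iso K (with_proj H)"
  shows "\<exists>f. induced_copy H G f"
proof -
  from iso obtain h where h: "pre_digraph.digraph_isomorphism K h"
    and H: "with_proj H = app_iso h K"
    by (auto simp: digraph_iso_def)
  have vH: "pverts H = iso_verts h ` verts K" and aH: "parcs H = iso_arcs h ` arcs K"
    and tH: "iso_tail h = fst" and hH: "iso_head h = snd"
    using arg_cong[OF H, of verts] arg_cong[OF H, of arcs] arg_cong[OF H, of tail]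
      arg_cong[OF H, of head] by simp_all
  have inj: "inj_on (iso_verts h) (verts K)" and wf: "wf_digraph K"
    and ends: "\<And>a. a \<in> arcs K \<Longrightarrow> iso_verts h (tail K a) = fst (iso_arcs h a) \<and>
      iso_verts h (head K a) = snd (iso_arcs h a)"
    using h by (auto simp: pre_digraph.digraph_isomorphism_def tH hH)
  have vK: "verts K \<subseteq> pverts G" and tK: "tail K = fst" and hK: "head K = snd"
    and aK: "arcs K = {e \<in> parcs G. fst e \<in> verts K \<and> snd e \<in> verts K}"
    using K by (auto simp: induced_subgraph_def subgraph_def compatible_def)
  have arc: "(iso_verts h x, iso_verts h y) \<in> parcs H \<longleftrightarrow> (x, y) \<in> parcs G"
    if xy: "x \<in> verts K" "y \<in> verts K" for x y
  proof
    assume "(iso_verts h x, iso_verts h y) \<in> parcs H"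
    then obtain a where a: "a \<in> arcs K" "iso_arcs h a = (iso_verts h x, iso_verts h y)"
      by (auto simp: aH)
    then have "fst a = x" "snd a = y"
      using ends[OF a(1)] inj xy aK by (auto simp: tK hK dest: inj_onD)
    then show "(x, y) \<in> parcs G" using a(1) aK by (cases a) auto
  next
    assume "(x, y) \<in> parcs G"
    then have a: "(x, y) \<in> arcs K" using xy aK by auto
    then have "iso_arcs h (x, y) = (iso_verts h x, iso_verts h y)"
      using ends[OF a] by (simp add: tK hK prod_eq_iff)
    then show "(iso_verts h x, iso_verts h y) \<in> parcs H"
      using a by (metis aH image_eqI)
  qed
  define f where "f = the_inv_into (verts K) (iso_verts h)"
  have f: "f (iso_verts h x) = x" if "x \<in> verts K" for x
    using inj that by (simp add: f_def the_inv_into_f_f)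
  have "induced_copy H G f"
    unfolding induced_copy_def vH using f vK arc by (auto intro!: inj_onI)
  then show ?thesis by blast
qed

lemma iso_if_induced_copy:
  assumes G: "pair_graph G" and H: "pair_graph H" and f: "induced_copy H G f"
  shows "\<exists>K. induced_subgraph K (with_proj G) \<and> digraph_iso K (with_proj H)"
proof -
  interpret G: pair_graph G by fact
  define K where "K = with_proj G \<restriction> (f ` pverts H)"
  have inj: "inj_on f (pverts H)" and sub: "f ` pverts H \<subseteq> pverts G"
    and arc: "\<And>u v. u \<in> pverts H \<Longrightarrow> v \<in> pverts H \<Longrightarrow>
      (f u, f v) \<in> parcs G \<longleftrightarrow> (u, v) \<in> parcs H"
    using f by (auto simp: induced_copy_def)
  have K: "induced_subgraph K (with_proj G)"
    unfolding K_def by (rule G.induced_induce) (use sub in simp)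
  define g where "g = the_inv_into (pverts H) f"
  have g: "g (f u) = u" if "u \<in> pverts H" for u
    using inj that by (simp add: g_def the_inv_into_f_f)
  define h where "h = \<lparr>iso_verts = g, iso_arcs = map_prod g g, iso_head = snd, iso_tail = fst\<rparr>"
  have arcsK: "arcs K = {(f u, f v) | u v. (u, v) \<in> parcs H}"
  proof (intro set_eqI iffI)
    fix e assume "e \<in> arcs K"
    then obtain u v where "u \<in> pverts H" "v \<in> pverts H" "e = (f u, f v)" "(f u, f v) \<in> parcs G"
      by (cases e) (auto simp: K_def)
    then show "e \<in> {(f u, f v) | u v. (u, v) \<in> parcs H}" using arc by blast
  next
    fix e assume "e \<in> {(f u, f v) | u v. (u, v) \<in> parcs H}"
    then obtain u v where uv: "(u, v) \<in> parcs H" "e = (f u, f v)" by blast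
    with pair_graphD(2)[OF H uv(1)] arc show "e \<in> arcs K" by (simp add: K_def)
  qed
  have hom: "pre_digraph.digraph_isomorphism K h"
    unfolding pre_digraph.digraph_isomorphism_def
  proof (intro conjI)
    show "wf_digraph K" using K by (auto simp: induced_subgraph_def subgraph_def)
    show "inj_on (iso_verts h) (verts K)"
      by (auto simp: h_def K_def g intro!: inj_onI)
    show "inj_on (iso_arcs h) (arcs K)"
      using pair_graphD(2)[OF H] unfolding arcsK
      by (intro inj_onI) (clarsimp simp: h_def, metis g)
  qed (simp add: h_def K_def)
  have "map_prod g g ` arcs K = parcs H"
  proof (intro set_eqI iffI)
    fix e assume "e \<in> map_prod g g ` arcs K"
    then show "e \<in> parcs H" using pair_graphD(2)[OF H] by (auto simp: arcsK g)
  next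
    fix e assume e: "e \<in> parcs H"
    obtain u v where uv: "e = (u, v)" by (cases e)
    then have "(f u, f v) \<in> arcs K" using e by (auto simp: arcsK)
    moreover have "e = map_prod g g (f u, f v)"
      using pair_graphD(2)[OF H] e uv g by auto
    ultimately show "e \<in> map_prod g g ` arcs K" by (rule rev_image_eqI)
  qed
  moreover have "g ` verts K = pverts H"
    by (force simp: K_def g)
  ultimately have "with_proj H = app_iso h K"
    by (simp add: app_iso_def with_proj_def h_def)
  with hom K show ?thesis by (auto simp: digraph_iso_def)
qed

text \<open>
  Replaces the existence of an isomorphic subgraph by the existence of an embedding, which can be
  given or refuted vertex by vertex.
\<close>

lemma free_graphs_iff:
  assumes "\<And>H. H \<in> \<F> \<Longrightarrow> pair_graph H"
  shows "G \<in> free_graphs \<F> \<longleftrightarrow> pair_graph G \<and> (\<forall>H\<in>\<F>. \<forall>f. \<not> induced_copy H G f)"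
  unfolding free_graphs_def
  using assms induced_copy_if_iso iso_if_induced_copy by blast

lemma pair_graph_P3_union_P2: "pair_graph P3_union_P2"
  unfolding P3_union_P2_def by (intro pair_graph_disjoint_union pair_graph_path_graph)

lemma pair_graph_gem: "pair_graph gem"
  unfolding gem_def by (intro pair_graph_graph_join pair_graph_complete_graph pair_graph_path_graph)

lemma P3_union_P2_simps:
  "pverts P3_union_P2 = {Inl 0, Inl 1, Inl 2, Inr 0, Inr 1}"
  "parcs P3_union_P2 = {(Inl 0, Inl 1), (Inl 1, Inl 0), (Inl 1, Inl 2), (Inl 2, Inl 1),
     (Inr 0, Inr 1), (Inr 1, Inr 0)}"
proof -
  have "{..<3::nat} = {0,1,2}" "{..<2::nat} = {0,1}" by auto
  then show "pverts P3_union_P2 = {Inl 0, Inl 1, Inl 2, Inr 0, Inr 1}"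
    by (auto simp: P3_union_P2_def disjoint_union_def path_graph_def Plus_def)
  have "parcs (path_graph 3) = {(0,1),(1,0),(1,2),(2,1)}" "parcs (path_graph 2) = {(0,1),(1,0)}"
    by (auto simp: path_graph_def)
  then show "parcs P3_union_P2 = {(Inl 0, Inl 1), (Inl 1, Inl 0), (Inl 1, Inl 2), (Inl 2, Inl 1),
     (Inr 0, Inr 1), (Inr 1, Inr 0)}"
    by (auto simp: P3_union_P2_def disjoint_union_def)
qed

lemma gem_arcs:
  "pverts gem = {Inl 0, Inr 0, Inr 1, Inr 2, Inr 3}"
  "i < 4 \<Longrightarrow> (Inl 0, Inr i) \<in> parcs gem"
  "(Inr i, Inr j) \<in> parcs gem \<longleftrightarrow> i < 4 \<and> j < 4 \<and> (j = Suc i \<or> i = Suc j)"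
proof -
  have "{..<1::nat} = {0}" "{..<4::nat} = {0,1,2,3}" by auto
  then show "pverts gem = {Inl 0, Inr 0, Inr 1, Inr 2, Inr 3}"
    by (auto simp: gem_def graph_join_def path_graph_def complete_graph_def Plus_def)
qed (auto simp: gem_def graph_join_def path_graph_def complete_graph_def image_iff)

section \<open>Cliques and colourings\<close>

lemma clique_number_bounds:
  assumes "finite (pverts G)"
  shows clique_card_le: "graph_clique G S \<Longrightarrow> card S \<le> clique_number G"
    and clique_number_attained: "\<exists>S. graph_clique G S \<and> card S = clique_number G"
proof -
  have fin: "finite {S. graph_clique G S}"
    by (rule finite_subset[of _ "Pow (pverts G)"]) (auto simp: graph_clique_def assms)
  then show "graph_clique G S \<Longrightarrow> card S \<le> clique_number G"
    by (simp add: clique_number_def)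
  have "graph_clique G {}" by (simp add: graph_clique_def)
  then have "card ` {S. graph_clique G S} \<noteq> {}" by blast
  from Max_in[OF _ this] fin show "\<exists>S. graph_clique G S \<and> card S = clique_number G"
    by (force simp: clique_number_def)
qed

lemma clique_number_eqI:
  assumes "finite (pverts G)" "graph_clique G S" "card S = n"
    and "\<And>T. graph_clique G T \<Longrightarrow> card T \<le> n"
  shows "clique_number G = n"
  using clique_number_bounds[OF assms(1)] assms(2-4) by (metis le_antisym)

lemma chromatic_number_le: "proper_colouring G k c \<Longrightarrow> chromatic_number G \<le> k"
  unfolding chromatic_number_def by (rule Least_le) blast

lemma chromatic_number_attained:
  "proper_colouring G k c \<Longrightarrow> \<exists>c'. proper_colouring G (chromatic_number G) c'"
  unfolding chromatic_number_def by (rule LeastI) blast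

text \<open>
  The colours of structural colourings are pairs of a set and a number rather than numbers.
\<close>

lemma chromatic_number_le_card:
  assumes fin: "finite C" and c: "\<And>v. v \<in> pverts G \<Longrightarrow> c v \<in> C"
    and proper: "\<And>u v. (u, v) \<in> parcs G \<Longrightarrow> u \<in> pverts G \<and> v \<in> pverts G \<and> c u \<noteq> c v"
  shows "chromatic_number G \<le> card C"
proof -
  obtain h where h: "bij_betw h C {0..<card C}"
    using fin ex_bij_betw_finite_nat by blast
  have "proper_colouring G (card C) (h \<circ> c)"
    unfolding proper_colouring_def
  proof safe
    fix v assume "v \<in> pverts G"
    then show "(h \<circ> c) v < card C" using h c by (fastforce dest: bij_betwE)
  next
    fix u v assume uv: "(u, v) \<in> parcs G" "(h \<circ> c) u = (h \<circ> c) v"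
    then have "c u = c v"
      using proper[OF uv(1)] c bij_betw_imp_inj_on[OF h] by (auto dest: inj_onD)
    then show False using proper[OF uv(1)] by simp
  qed
  then show ?thesis by (rule chromatic_number_le)
qed

section \<open>A bound for graphs without induced \<open>P\<^sub>3 \<union> P\<^sub>2\<close>\<close>

text \<open>
  The set \<open>M v\<close> of non-neighbours of v in a maximum clique A is never empty, since otherwise v would
  enlarge A. Adjacency is transitive on each set of vertices with equal \<open>M\<close> (\<open>no_P3\<close>): a path with
  non-adjacent ends would form a \<open>P\<^sub>3 \<union> P\<^sub>2\<close> together with two elements of \<open>M v\<close>, and if \<open>M v\<close> is a
  singleton \<open>{a}\<close>, already one edge uv would make \<open>A - {a} \<union> {u, v}\<close> a larger clique. Hence such a
  set is a disjoint union of cliques, and the colour of a vertex is its rank in its own clique. The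
  linear order on the vertices serves only to define this rank.
\<close>

lemma chromatic_number_le_if_P3_union_P2_free:
  fixes G :: "'a::linorder pair_pre_digraph"
  assumes G: "pair_graph G" and free: "\<And>f. \<not> induced_copy P3_union_P2 G f"
  shows "chromatic_number G \<le> 2 ^ clique_number G * clique_number G"
proof -
  note fin = pair_graphD(1)[OF G]
  have arcD: "u \<in> pverts G" "v \<in> pverts G" "u \<noteq> v" "(v, u) \<in> parcs G"
    if "(u, v) \<in> parcs G" for u v
    using pair_graphD(2)[OF G that] by auto
  let ?w = "clique_number G"
  obtain A where A: "graph_clique G A" and cardA: "card A = ?w"
    using clique_number_attained[OF fin] by blast
  have AV: "A \<subseteq> pverts G" and A_adj: "\<And>a b. a \<in> A \<Longrightarrow> b \<in> A \<Longrightarrow> a \<noteq> b \<Longrightarrow> (a, b) \<in> parcs G"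
    using A by (auto simp: graph_clique_def)
  have finA: "finite A" using AV fin finite_subset by blast
  define M where "M v = {a \<in> A. (a, v) \<notin> parcs G}" for v
  have M_sub: "M v \<subseteq> A" for v by (auto simp: M_def)
  have M_self: "v \<in> M v" if "v \<in> A" for v using that arcD(3) by (auto simp: M_def)
  have M_ne: "M v \<noteq> {}" if v: "v \<in> pverts G" for v
  proof
    assume e: "M v = {}"
    then have "v \<notin> A" using M_self by blast
    have "graph_clique G (insert v A)"
      using e v AV A_adj arcD(4) by (auto simp: graph_clique_def M_def)
    from clique_card_le[OF fin this] show False using \<open>v \<notin> A\<close> cardA finA by simp
  qed
  have no_P3: "(u, w) \<in> parcs G"
    if uv: "(u, v) \<in> parcs G" and vw: "(v, w) \<in> parcs G" and "u \<noteq> w"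
      and Mu: "M u = M v" and Mw: "M w = M v" for u v w
  proof (rule ccontr)
    assume uw: "(u, w) \<notin> parcs G"
    obtain a where a: "a \<in> M v" using M_ne arcD(2)[OF uv] by blast
    \<comment> \<open>One common non-neighbour a can be exchanged for u and v; two of them are a forbidden edge.\<close>
    show False
    proof (cases "M v = {a}")
      case True
      have notin: "u \<notin> A - {a}" "v \<notin> A - {a}" using M_self Mu True by auto
      have "graph_clique G (insert u (insert v (A - {a})))"
        using uv arcD[OF uv] AV A_adj True Mu arcD(4) by (auto simp: graph_clique_def M_def)
      from clique_card_le[OF fin this]
      have "card (insert u (insert v (A - {a}))) \<le> ?w" .
      moreover have "card (insert u (insert v (A - {a}))) = Suc (Suc (card (A - {a})))"
        using notin arcD(3)[OF uv] finA by simp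
      moreover have "Suc (card (A - {a})) = ?w"
        using a M_sub finA cardA by (metis card_Suc_Diff1 subsetD)
      ultimately show False by simp
    next
      case False
      then obtain b where b: "b \<in> M v" "b \<noteq> a" using a by blast
      have ab: "a \<in> A" "b \<in> A" "(a, b) \<in> parcs G" "(b, a) \<in> parcs G"
        using a b A_adj by (auto simp: M_def)
      have non: "x \<noteq> y \<and> (x, y) \<notin> parcs G \<and> (y, x) \<notin> parcs G"
        if "x \<in> {a, b}" "y \<in> {u, v, w}" for x y
      proof -
        have M: "M y = M v" using that Mu Mw by auto
        then have na: "(x', y) \<notin> parcs G" if "x' \<in> {a, b}" for x'
          using a b that by (auto simp: M_def)
        have "x \<noteq> y" using that(1) ab na by auto
        then show ?thesis using na[OF that(1)] arcD(4) by blast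
      qed
      define f where "f = case_sum (\<lambda>i::nat. if i = 0 then u else if i = 1 then v else w)
        (\<lambda>i::nat. if i = 0 then a else b)"
      have nl: "(x, x) \<notin> parcs G" for x using arcD(3) by blast
      have "induced_copy P3_union_P2 G f"
        unfolding induced_copy_def P3_union_P2_simps f_def
        using non[of a u] non[of a v] non[of a w] non[of b u] non[of b v] non[of b w]
          uv vw \<open>u \<noteq> w\<close> uw ab b(2) arcD[OF uv] arcD[OF vw] AV nl arcD(4)[of w u]
        by auto
      then show False using free by blast
    qed
  qed
  define B where "B v = {w. (w, v) \<in> parcs G \<and> M w = M v \<and> w < v}" for v
  have B_sub: "B v \<subseteq> pverts G" for v using arcD(1) by (auto simp: B_def)
  have finB: "finite (B v)" for v using B_sub fin finite_subset by blast
  have rank_less: "card (B v) < ?w" if v: "v \<in> pverts G" for v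
  proof -
    have "(x, y) \<in> parcs G" if "x \<in> B v" "y \<in> B v" "x \<noteq> y" for x y
      using that no_P3[of x v y] arcD(4)[of y v] by (auto simp: B_def)
    moreover have "(x, v) \<in> parcs G \<and> (v, x) \<in> parcs G" if "x \<in> B v" for x
      using that arcD(4) by (simp add: B_def)
    ultimately have "graph_clique G (insert v (B v))"
      using v B_sub unfolding graph_clique_def by blast
    from clique_card_le[OF fin this] show ?thesis using finB by (auto simp: B_def)
  qed
  have rank_strict: "card (B u) < card (B v)"
    if uv: "(u, v) \<in> parcs G" "M u = M v" "u < v" for u v
  proof -
    have "x \<in> B v" if "x \<in> B u" for x
    proof -
      have x: "(x, u) \<in> parcs G" "M x = M u" "x < u" using that by (auto simp: B_def)
      then have "x < v" "x \<noteq> v" using uv(3) by auto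
      then have "(x, v) \<in> parcs G" using no_P3[OF x(1) uv(1) _ x(2)] uv(2) by simp
      then show ?thesis using \<open>x < v\<close> x(2) uv(2) by (simp add: B_def)
    qed
    then have "insert u (B u) \<subseteq> B v"
      using uv by (auto simp: B_def)
    then have "card (insert u (B u)) \<le> card (B v)" using finB card_mono by blast
    then show ?thesis using finB by (simp add: B_def)
  qed
  have "chromatic_number G \<le> card (Pow A \<times> {..<?w})"
  proof (rule chromatic_number_le_card[where c = "\<lambda>v. (M v, card (B v))"])
    show "finite (Pow A \<times> {..<?w})" using finA by simp
    show "(M v, card (B v)) \<in> Pow A \<times> {..<?w}" if "v \<in> pverts G" for v
      using M_sub rank_less[OF that] by auto
    show "u \<in> pverts G \<and> v \<in> pverts G \<and> (M u, card (B u)) \<noteq> (M v, card (B v))"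
      if uv: "(u, v) \<in> parcs G" for u v
    proof -
      have "card (B u) \<noteq> card (B v)" if M: "M u = M v"
      proof (cases "u < v")
        case True
        then show ?thesis using rank_strict[OF uv M] by simp
      next
        case False
        then have "v < u" using arcD(3)[OF uv] by simp
        then show ?thesis using rank_strict[OF arcD(4)[OF uv] M[symmetric]] by simp
      qed
      then show ?thesis using arcD[OF uv] by blast
    qed
  qed
  then show ?thesis by (simp add: card_cartesian_product card_Pow finA cardA)
qed

section \<open>Existence of the optimal binding function\<close>

text \<open>
  Both forbidden graphs have a pair of distinct non-adjacent vertices.
\<close>

lemma complete_graph_free: "complete_graph n \<in> free_graphs {P3_union_P2, gem}"
proof -
  have "\<not> induced_copy H (complete_graph n) f"
    if uv: "u \<in> pverts H" "v \<in> pverts H" "u \<noteq> v" "(u, v) \<notin> parcs H"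
    for H :: "(nat + nat) pair_pre_digraph" and u v f
  proof
    assume f: "induced_copy H (complete_graph n) f"
    then have "f u \<noteq> f v" "f u < n" "f v < n"
      using uv by (auto simp: induced_copy_def complete_graph_def dest: inj_onD)
    then have "(f u, f v) \<in> parcs (complete_graph n)" by (simp add: complete_graph_def)
    then show False using f uv by (simp add: induced_copy_def)
  qed
  from this[of "Inl 0" P3_union_P2 "Inl 2"] this[of "Inr 0" gem "Inr 2"] show ?thesis
    by (subst free_graphs_iff)
      (auto simp: pair_graph_P3_union_P2 pair_graph_gem pair_graph_complete_graph
        P3_union_P2_simps gem_arcs)
qed

lemma clique_number_complete_graph: "clique_number (complete_graph n) = n"
proof (rule clique_number_eqI[where S = "{..<n}"])
  show "card T \<le> n" if "graph_clique (complete_graph n) T" for T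
    using that card_mono[of "{..<n}" T] by (simp add: graph_clique_def complete_graph_def)
qed (auto simp: graph_clique_def complete_graph_def)

text \<open>
  Both hypotheses matter for the witness, the pointwise maximum: it needs a bounded set of
  chromatic numbers to be defined, and a member attaining it to lie below every binding function.
\<close>

lemma optimal_chi_binding_exists:
  fixes \<G> :: "'a pair_pre_digraph set"
  assumes bound: "\<And>G. G \<in> \<G> \<Longrightarrow> chromatic_number G \<le> b (clique_number G)"
    and realised: "\<And>x. \<exists>G\<in>\<G>. clique_number G = x"
  shows "\<exists>f. optimal_chi_binding \<G> f"
proof -
  define X where "X x = chromatic_number ` {G \<in> \<G>. clique_number G = x}" for x
  have "X x \<subseteq> {..b x}" for x using bound by (auto simp: X_def)
  then have fin: "finite (X x)" for x using finite_subset by blast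
  have ne: "X x \<noteq> {}" for x using realised by (auto simp: X_def)
  have "chi_binding \<G> (\<lambda>x. real (Max (X x)))"
    using fin by (auto simp: chi_binding_def X_def)
  moreover have "real (Max (X x)) \<le> g x" if g: "chi_binding \<G> g" for g x
    using Max_in[OF fin ne, of x] g by (auto simp: X_def chi_binding_def)
  ultimately show ?thesis unfolding optimal_chi_binding_def by blast
qed


section \<open>The 5-cycle\<close>

text \<open>
  Adjacency made reflexive: vertices of an expansion that sit in the same clique are adjacent, too.
\<close>

definition near :: "nat \<Rightarrow> nat \<Rightarrow> bool" where
  "near p q \<longleftrightarrow> p = q \<or> (p, q) \<in> parcs (cycle_graph 5)"

lemma near_sym: "near p q \<Longrightarrow> near q p"
  by (auto simp: near_def cycle_graph_def)

lemma near_commute: "near p q \<longleftrightarrow> near q p"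
  using near_sym by blast

lemma less_5_cases: "p < 5 \<Longrightarrow> p = 0 \<or> p = 1 \<or> p = 2 \<or> p = 3 \<or> p = 4" for p :: nat
  by arith

lemma near_iff:
  "near p q \<longleftrightarrow> p = q \<or> p < 5 \<and> q < 5 \<and>
    (q = (if p = 4 then 0 else Suc p) \<or> p = (if q = 4 then 0 else Suc q))"
  by (cases "p < 5 \<and> q < 5") (auto simp: near_def cycle_graph_def mod_Suc)

lemma near_table:
  "near 0 q \<longleftrightarrow> q = 0 \<or> q = 1 \<or> q = 4"
  "near 1 q \<longleftrightarrow> q = 0 \<or> q = 1 \<or> q = 2"
  "near 2 q \<longleftrightarrow> q = 1 \<or> q = 2 \<or> q = 3"
  "near 3 q \<longleftrightarrow> q = 2 \<or> q = 3 \<or> q = 4"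
  "near 4 q \<longleftrightarrow> q = 0 \<or> q = 3 \<or> q = 4"
  unfolding near_iff by (simp_all split: if_split) arith+

lemma near_less_cases:
  assumes "near p q" "p < q"
  obtains "q = Suc p" | "p = 0" "q = 4"
  using assms by (auto simp: near_iff split: if_splits)

lemmas near_simps = near_table near_table[THEN trans[OF near_commute]]

text \<open>The path occupies b and its two neighbours on the cycle, and only two positions remain.\<close>

lemma C5_path_dominating:
  assumes "b < 5" "d < 5"
    and "near a b" "near b c" "\<not> near a c"
  shows "near d a \<or> near d b \<or> near d c"
  using less_5_cases[OF assms(1)] less_5_cases[OF assms(2)] assms(3-)
  by (elim disjE) (auto simp: near_simps simp del: One_nat_def)

text \<open>
  The closed neighbourhood of x is a path centred at x, whose only pair of unrelated positions is
  the pair of its ends.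
\<close>

lemma C5_nonneighbour_unique:
  assumes "x < 5"
    and "near x a" "near x c" "near x d" "\<not> near a c" "\<not> near a d"
  shows "c = d"
  using less_5_cases[OF assms(1)] assms(2-)
  by (elim disjE) (auto simp: near_simps simp del: One_nat_def)

lemma C5_triangle_free:
  assumes "p < 5" "near p q" "near p r" "near q r"
  shows "r = p \<or> r = q \<or> p = q"
  using less_5_cases[OF assms(1)] assms(2-)
  by (elim disjE) (auto simp: near_simps simp del: One_nat_def)

lemma C5_independence:
  assumes "p < 5" "q < 5" "r < 5"
  shows "near p q \<or> near p r \<or> near q r"
  using less_5_cases[OF assms(1)] less_5_cases[OF assms(2)] less_5_cases[OF assms(3)]
  by (elim disjE) (simp_all add: near_simps del: One_nat_def)

section \<open>Blow-ups of the 5-cycle\<close>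

text \<open>
  The complete expansions of the 5-cycle up to isomorphism, with the projection to the cycle as
  data. Leaving the vertex type open lets the results apply to the expansions themselves, whose
  vertices are pairs, and to copies with natural numbers as vertices, which belong to the class
  on which binding functions are tested.
\<close>

definition C5_blowup :: "'a pair_pre_digraph \<Rightarrow> nat \<Rightarrow> ('a \<Rightarrow> nat) \<Rightarrow> bool" where
  "C5_blowup G m \<pi> \<longleftrightarrow> finite (pverts G) \<and> \<pi> ` pverts G \<subseteq> {..<5} \<and>
    (\<forall>p<5. card {v \<in> pverts G. \<pi> v = p} = m) \<and>
    (\<forall>u v. (u, v) \<in> parcs G \<longleftrightarrow>
      u \<in> pverts G \<and> v \<in> pverts G \<and> u \<noteq> v \<and> near (\<pi> u) (\<pi> v))"

lemma C5_blowupD: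
  assumes "C5_blowup G m \<pi>"
  shows "finite (pverts G)"
    and "v \<in> pverts G \<Longrightarrow> \<pi> v < 5"
    and "p < 5 \<Longrightarrow> card {v \<in> pverts G. \<pi> v = p} = m"
    and "(u, v) \<in> parcs G \<longleftrightarrow> u \<in> pverts G \<and> v \<in> pverts G \<and> u \<noteq> v \<and> near (\<pi> u) (\<pi> v)"
  using assms by (auto simp: C5_blowup_def)

lemma C5_blowup_pair_graph:
  assumes G: "C5_blowup G m \<pi>"
  shows "pair_graph G"
proof (rule pair_graphI)
  show "finite (pverts G)" by (rule C5_blowupD(1)[OF G])
  fix u v assume "(u, v) \<in> parcs G"
  then show "u \<in> pverts G \<and> v \<in> pverts G \<and> u \<noteq> v \<and> (v, u) \<in> parcs G"
    using near_sym unfolding C5_blowupD(4)[OF G] by blast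
qed

lemma C5_blowup_complete_expansion:
  "C5_blowup (complete_expansion (cycle_graph 5) (\<lambda>_. m)) m fst"
  unfolding C5_blowup_def
proof (intro conjI allI impI)
  fix p :: nat assume "p < 5"
  then have "{v \<in> pverts (complete_expansion (cycle_graph 5) (\<lambda>_. m)). fst v = p} = {p} \<times> {..<m}"
    by (auto simp: complete_expansion_def cycle_graph_def)
  then show "card {v \<in> pverts (complete_expansion (cycle_graph 5) (\<lambda>_. m)). fst v = p} = m"
    by (simp add: card_cartesian_product)
qed (auto simp: complete_expansion_def cycle_graph_def near_def mod_Suc split: if_splits)

lemma C5_blowup_nat_copy:
  assumes "C5_blowup (G :: 'a::countable pair_pre_digraph) m \<pi>"
  shows "\<exists>(G' :: nat pair_pre_digraph) \<pi>'. C5_blowup G' m \<pi>'"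
proof -
  define G' where "G' = \<lparr>pverts = to_nat ` pverts G,
    parcs = map_prod to_nat to_nat ` parcs G\<rparr>"
  have "{v \<in> pverts G'. (\<pi> \<circ> from_nat) v = p} = to_nat ` {v \<in> pverts G. \<pi> v = p}" for p
    by (auto simp: G'_def)
  then have "card {v \<in> pverts G'. (\<pi> \<circ> from_nat) v = p} = m" if "p < 5" for p
    using C5_blowupD(3)[OF assms that] by (simp add: card_image)
  moreover have "(x, y) \<in> parcs G' \<longleftrightarrow> x \<in> pverts G' \<and> y \<in> pverts G' \<and> x \<noteq> y \<and>
      near ((\<pi> \<circ> from_nat) x) ((\<pi> \<circ> from_nat) y)" for x y
  proof
    assume "(x, y) \<in> parcs G'"
    then obtain u v where "x = to_nat u" "y = to_nat v" "(u, v) \<in> parcs G" by (auto simp: G'_def)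
    then show "x \<in> pverts G' \<and> y \<in> pverts G' \<and> x \<noteq> y \<and>
        near ((\<pi> \<circ> from_nat) x) ((\<pi> \<circ> from_nat) y)"
      unfolding C5_blowupD(4)[OF assms] by (simp add: G'_def)
  next
    assume "x \<in> pverts G' \<and> y \<in> pverts G' \<and> x \<noteq> y \<and>
        near ((\<pi> \<circ> from_nat) x) ((\<pi> \<circ> from_nat) y)"
    then obtain u v where uv: "x = to_nat u" "y = to_nat v"
      and "u \<in> pverts G" "v \<in> pverts G" "u \<noteq> v" "near (\<pi> u) (\<pi> v)"
      by (auto simp: G'_def)
    then have "(u, v) \<in> parcs G" unfolding C5_blowupD(4)[OF assms] by blast
    then show "(x, y) \<in> parcs G'"
      unfolding uv by (auto simp: G'_def intro: rev_image_eqI)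
  qed
  moreover have "finite (pverts G')" "(\<pi> \<circ> from_nat) ` pverts G' \<subseteq> {..<5}"
    using C5_blowupD(1,2)[OF assms] by (auto simp: G'_def)
  ultimately have "C5_blowup G' m (\<pi> \<circ> from_nat)"
    unfolding C5_blowup_def by blast
  then show ?thesis by blast
qed

text \<open>
  An embedded graph has its arcs determined by the positions of the images (\<open>near_copy\<close>), so both
  forbidden graphs contradict a fact about the 5-cycle.
\<close>

lemma C5_blowup_free:
  assumes G: "C5_blowup G m \<pi>"
  shows "G \<in> free_graphs {P3_union_P2, gem}"
proof -
  have near_copy: "near (\<pi> (f u)) (\<pi> (f v)) \<longleftrightarrow> (u, v) \<in> parcs H"
    and less5: "\<pi> (f u) < 5"
    if "induced_copy H G f" "u \<in> pverts H" "v \<in> pverts H" "u \<noteq> v"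
    for H :: "(nat + nat) pair_pre_digraph" and f u v
  proof -
    have fuv: "f u \<in> pverts G" "f v \<in> pverts G" "f u \<noteq> f v"
      using that by (auto simp: induced_copy_def dest: inj_onD)
    then show "\<pi> (f u) < 5" by (simp add: C5_blowupD(2)[OF G])
    have "(f u, f v) \<in> parcs G \<longleftrightarrow> (u, v) \<in> parcs H"
      using that by (simp add: induced_copy_def)
    then show "near (\<pi> (f u)) (\<pi> (f v)) \<longleftrightarrow> (u, v) \<in> parcs H"
      using fuv by (simp add: C5_blowupD(4)[OF G])
  qed
  have "\<not> induced_copy P3_union_P2 G f" for f
  proof
    assume f: "induced_copy P3_union_P2 G f"
    let ?a = "\<pi> (f (Inl 0))" and ?b = "\<pi> (f (Inl 1))" and ?c = "\<pi> (f (Inl 2))"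
      and ?d = "\<pi> (f (Inr 0))"
    have "near ?a ?b" "near ?b ?c" "\<not> near ?a ?c" "\<not> near ?d ?a" "\<not> near ?d ?b" "\<not> near ?d ?c"
      by (subst near_copy[OF f]; simp add: P3_union_P2_simps)+
    moreover have "?b < 5" "?d < 5"
      using less5[OF f, of _ "Inr 1"] by (simp_all add: P3_union_P2_simps)
    ultimately show False using C5_path_dominating[of ?b ?d ?a ?c] by blast
  qed
  moreover have "\<not> induced_copy gem G f" for f
  proof
    assume f: "induced_copy gem G f"
    let ?x = "\<pi> (f (Inl 0))" and ?a = "\<pi> (f (Inr 0))" and ?b = "\<pi> (f (Inr 1))"
      and ?c = "\<pi> (f (Inr 2))" and ?d = "\<pi> (f (Inr 3))"
    have "near ?x ?a" "near ?x ?c" "near ?x ?d" "\<not> near ?a ?c" "\<not> near ?a ?d"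
      and bcd: "near ?b ?c" "\<not> near ?b ?d"
      by (subst near_copy[OF f]; simp add: gem_arcs)+
    moreover have "?x < 5"
      using less5[OF f, of _ "Inr 3"] by (simp_all add: gem_arcs)
    ultimately have "?c = ?d" using C5_nonneighbour_unique[of ?x ?a ?c ?d] by blast
    then show False using bcd by simp
  qed
  ultimately show ?thesis
    by (subst free_graphs_iff)
      (auto simp: pair_graph_P3_union_P2 pair_graph_gem C5_blowup_pair_graph[OF G])
qed

lemma C5_blowup_two_fibres:
  assumes G: "C5_blowup G m \<pi>" and "p < 5" "q < 5" "p \<noteq> q"
  shows "card {v \<in> pverts G. \<pi> v \<in> {p, q}} = 2 * m"
proof -
  have "{v \<in> pverts G. \<pi> v \<in> {p, q}} = {v \<in> pverts G. \<pi> v = p} \<union> {v \<in> pverts G. \<pi> v = q}"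
    by auto
  also have "card \<dots> = m + m"
    using assms C5_blowupD[OF G] by (subst card_Un_disjoint) auto
  finally show ?thesis by simp
qed

lemma C5_blowup_clique_number:
  assumes G: "C5_blowup G m \<pi>"
  shows "clique_number G = 2 * m"
proof (rule clique_number_eqI[where S = "{v \<in> pverts G. \<pi> v \<in> {0, 1}}"])
  show "finite (pverts G)" by (rule C5_blowupD(1)[OF G])
  show "graph_clique G {v \<in> pverts G. \<pi> v \<in> {0, 1}}"
    by (auto simp: graph_clique_def C5_blowupD(4)[OF G] near_simps simp del: One_nat_def)
  show "card {v \<in> pverts G. \<pi> v \<in> {0, 1}} = 2 * m"
    by (rule C5_blowup_two_fibres[OF G]) auto
  fix T assume T: "graph_clique G T"
  then have TV: "T \<subseteq> pverts G" by (simp add: graph_clique_def)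
  have near: "near (\<pi> u) (\<pi> v)" if "u \<in> T" "v \<in> T" for u v
    using that T C5_blowupD(4)[OF G] by (cases "u = v") (auto simp: graph_clique_def near_def)
  show "card T \<le> 2 * m"
  proof (cases "T = {}")
    case False
    then obtain u where u: "u \<in> T" by blast
    \<comment> \<open>If T lies in one position only, any other position serves as q.\<close>
    obtain q where q: "q < 5" "q \<noteq> \<pi> u" "\<forall>v\<in>T. \<pi> v \<in> {\<pi> u, q}"
    proof (cases "\<exists>w\<in>T. \<pi> w \<noteq> \<pi> u")
      case True
      then obtain w where w: "w \<in> T" "\<pi> w \<noteq> \<pi> u" by blast
      then have "\<forall>v\<in>T. \<pi> v \<in> {\<pi> u, \<pi> w}"
        using C5_triangle_free[of "\<pi> u" "\<pi> w"] near u TV C5_blowupD(2)[OF G]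
        by (metis insert_iff subsetD)
      then show thesis using that[of "\<pi> w"] w TV C5_blowupD(2)[OF G] by blast
    next
      case False
      then show thesis using that[of "if \<pi> u = 0 then 1 else 0"] by auto
    qed
    have "T \<subseteq> {v \<in> pverts G. \<pi> v \<in> {\<pi> u, q}}" using q TV u by blast
    then have "card T \<le> card {v \<in> pverts G. \<pi> v \<in> {\<pi> u, q}}"
      using C5_blowupD(1)[OF G] by (intro card_mono) auto
    then show ?thesis
      using C5_blowup_two_fibres[OF G, of "\<pi> u" q] q u TV C5_blowupD(2)[OF G] by auto
  qed simp
qed

lemma mod_neqI:
  fixes x y k :: nat
  assumes "x < y" "y < x + k \<or> x + k < y \<and> y < x + 2 * k"
  shows "x mod k \<noteq> y mod k"
proof
  assume "x mod k = y mod k"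
  then have "k dvd y - x" using assms(1) by (metis mod_eq_dvd_iff_nat less_imp_le)
  then obtain t where t: "y - x = k * t" by blast
  have "t \<noteq> 0" "t \<noteq> 1" using t assms by (auto intro: gr0I)
  then have "k * 2 \<le> k * t" by (intro mult_le_mono2) simp
  then show False using t assms by linarith
qed

text \<open>
  Vertex i of the clique at position p gets the colour \<open>p * m + i\<close> modulo k, so the positions use
  consecutive cyclic intervals of length m. Neighbouring intervals are disjoint because
  \<open>2 * m \<le> k\<close>. Position 4 has the interval from \<open>4 * m\<close> to \<open>5 * m\<close>, which lies between
  \<open>k + m\<close> and \<open>2 * k\<close>, so on its second turn around the palette it misses the interval of
  position 0.
\<close>

lemma interval_colouring:
  fixes m p q i j :: nat
  assumes near: "near p q" and ij: "i < m" "j < m" and ne: "(p, i) \<noteq> (q, j)"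
  defines "k \<equiv> (5 * m + 1) div 2"
  shows "(p * m + i) mod k \<noteq> (q * m + j) mod k"
proof -
  have k: "5 * m \<le> 2 * k" "2 * m \<le> k" "k \<le> 3 * m" using ij unfolding k_def by linarith+
  have *: "(p * m + i) mod k \<noteq> (q * m + j) mod k"
    if "near p q" and ij: "i < m" "j < m" and lt: "p < q \<or> p = q \<and> i < j" for p q i j
  proof (rule mod_neqI)
    consider "p = q" "i < j" | "q = Suc p" | "p = 0" "q = 4"
      using lt near_less_cases[OF \<open>near p q\<close>] by blast
    note cases = this
    show "p * m + i < q * m + j"
      using ij lt by (cases rule: cases) auto
    show "q * m + j < p * m + i + k \<or>
      p * m + i + k < q * m + j \<and> q * m + j < p * m + i + 2 * k"
      using ij lt k by (cases rule: cases) auto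
  qed
  consider "p < q \<or> p = q \<and> i < j" | "q < p \<or> q = p \<and> j < i"
    using ne by (metis linorder_neqE_nat)
  then show ?thesis
  proof cases
    case 1 then show ?thesis using * near ij by blast
  next
    case 2 then show ?thesis using *[OF near_sym[OF near]] ij by metis
  qed
qed

lemma C5_blowup_colourable:
  assumes G: "C5_blowup G m \<pi>"
  shows "\<exists>c. proper_colouring G ((5 * m + 1) div 2) c"
proof -
  let ?k = "(5 * m + 1) div 2"
  have "\<exists>e. bij_betw e {v \<in> pverts G. \<pi> v = p} {0..<m}" if "p < 5" for p
    using ex_bij_betw_finite_nat[of "{v \<in> pverts G. \<pi> v = p}"] C5_blowupD(1,3)[OF G] that
    by force
  then obtain e where e: "\<And>p. p < 5 \<Longrightarrow> bij_betw (e p) {v \<in> pverts G. \<pi> v = p} {0..<m}"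
    by metis
  define i where "i v = e (\<pi> v) v" for v
  have i_less: "i v < m" if "v \<in> pverts G" for v
    using bij_betwE[OF e[OF C5_blowupD(2)[OF G that]]] that by (auto simp: i_def)
  have i_inj: "u = v" if "u \<in> pverts G" "v \<in> pverts G" "\<pi> u = \<pi> v" "i u = i v" for u v
    using bij_betw_imp_inj_on[OF e[OF C5_blowupD(2)[OF G that(1)]]] that
    by (auto simp: i_def dest: inj_onD)
  have "proper_colouring G ?k (\<lambda>v. (\<pi> v * m + i v) mod ?k)"
    unfolding proper_colouring_def
  proof (intro conjI ballI, goal_cases)
    case (1 v)
    then have "0 < ?k" using i_less[of v] by linarith
    then show ?case by simp
  next
    case (2 uv)
    obtain u v where uv: "uv = (u, v)" by (cases uv)
    show ?case
      using 2 interval_colouring[of "\<pi> u" "\<pi> v" "i u" m "i v"] i_less i_inj C5_blowupD(2,4)[OF G]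
      unfolding uv by auto
  qed
  then show ?thesis by blast
qed

lemma card_le_2I:
  assumes "\<And>x y z. x \<in> X \<Longrightarrow> y \<in> X \<Longrightarrow> z \<in> X \<Longrightarrow> x = y \<or> x = z \<or> y = z"
  shows "card X \<le> 2"
proof (rule ccontr)
  assume "\<not> card X \<le> 2"
  then have "3 \<le> card X" by simp
  then obtain T where T: "T \<subseteq> X" "card T = 3" by (metis obtain_subset_with_card_n)
  then obtain x y z where "T = {x, y, z}" "x \<noteq> y" "x \<noteq> z" "y \<noteq> z" by (auto simp: card_3_iff)
  with T(1) assms[of x y z] show False by auto
qed

lemma C5_blowup_card:
  assumes G: "C5_blowup G m \<pi>"
  shows "card (pverts G) = 5 * m"
proof -
  have "pverts G = (\<Union>p\<in>{..<5}. {v \<in> pverts G. \<pi> v = p})" using C5_blowupD(2)[OF G] by auto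
  then have "card (pverts G) = card (\<Union>p\<in>{..<5}. {v \<in> pverts G. \<pi> v = p})" by simp
  also have "\<dots> = (\<Sum>p<5. card {v \<in> pverts G. \<pi> v = p})"
    using C5_blowupD(1)[OF G] by (intro card_UN_disjoint) auto
  finally show ?thesis using C5_blowupD(3)[OF G] by simp
qed

text \<open>
  Vertices in a common colour class have pairwise unrelated positions, and the 5-cycle has no three
  such positions. So each class holds at most two of the 5m vertices.
\<close>

lemma C5_blowup_colours_ge:
  assumes G: "C5_blowup G m \<pi>" and c: "proper_colouring G k c"
  shows "5 * m \<le> 2 * k"
proof -
  have "card {v \<in> pverts G. c v = j} \<le> 2" for j
  proof (rule card_le_2I)
    fix x y z assume "x \<in> {v \<in> pverts G. c v = j}" "y \<in> {v \<in> pverts G. c v = j}"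
      "z \<in> {v \<in> pverts G. c v = j}"
    then have V: "x \<in> pverts G" "y \<in> pverts G" "z \<in> pverts G"
      and "(x, y) \<notin> parcs G" "(x, z) \<notin> parcs G" "(y, z) \<notin> parcs G"
      using c by (auto simp: proper_colouring_def)
    then show "x = y \<or> x = z \<or> y = z"
      using C5_independence[of "\<pi> x" "\<pi> y" "\<pi> z"] C5_blowupD(2,4)[OF G] by blast
  qed
  note le2 = this
  have "pverts G = (\<Union>j\<in>{..<k}. {v \<in> pverts G. c v = j})"
    using c by (auto simp: proper_colouring_def)
  then have "card (pverts G) \<le> (\<Sum>j<k. card {v \<in> pverts G. c v = j})"
    using card_UN_le[of "{..<k}" "\<lambda>j. {v \<in> pverts G. c v = j}"] by simp
  also have "\<dots> \<le> (\<Sum>j<k. 2)" by (intro sum_mono le2)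
  finally show ?thesis by (simp add: C5_blowup_card[OF G])
qed

lemma C5_blowup_chromatic_number:
  assumes G: "C5_blowup G m \<pi>"
  shows "chromatic_number G = (5 * m + 1) div 2"
proof (rule antisym)
  obtain c where c: "proper_colouring G ((5 * m + 1) div 2) c"
    using C5_blowup_colourable[OF G] by blast
  then show "chromatic_number G \<le> (5 * m + 1) div 2" by (rule chromatic_number_le)
  from chromatic_number_attained[OF c] C5_blowup_colours_ge[OF G]
  have "5 * m \<le> 2 * chromatic_number G" by blast
  then show "(5 * m + 1) div 2 \<le> chromatic_number G" by linarith
qed

lemma ceiling_five_quarters: "\<lceil>5 * real (2 * m) / 4\<rceil> = int ((5 * m + 1) div 2)"
proof (rule ceiling_unique)
  have "(5 * m + 1) div 2 * 2 \<le> 5 * m + 1" "5 * m \<le> (5 * m + 1) div 2 * 2" by linarith+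
  then have "real ((5 * m + 1) div 2) * 2 \<le> 5 * real m + 1" "5 * real m \<le> real ((5 * m + 1) div 2) * 2"
    by (metis (mono_tags) of_nat_le_iff of_nat_mult of_nat_add of_nat_1 of_nat_numeral)+
  then show "real_of_int (int ((5 * m + 1) div 2)) - 1 < 5 * real (2 * m) / 4"
    "5 * real (2 * m) / 4 \<le> real_of_int (int ((5 * m + 1) div 2))" by simp_all
qed

section \<open>The lower bound\<close>

theorem mainTheorem2:
  fixes \<G> :: "nat pair_pre_digraph set"
    and G :: "nat \<Rightarrow> (nat \<times> nat) pair_pre_digraph"
  assumes \<G>_def: "\<G> = free_graphs {P3_union_P2, gem}"
    and G_def: "\<And>m. G m = complete_expansion (cycle_graph 5) (\<lambda>_. m)"
  shows "(\<forall>m\<ge>1. G m \<in> free_graphs {P3_union_P2, gem} \<and>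
            clique_number (G m) = 2 * m \<and>
            int (chromatic_number (G m)) = \<lceil>5 * real (clique_number (G m)) / 4\<rceil>) \<and>
         (\<exists>f_opt. optimal_chi_binding \<G> f_opt \<and>
            (\<forall>m\<ge>1. f_opt (clique_number (G m))
                     \<ge> real_of_int \<lceil>5 * real (clique_number (G m)) / 4\<rceil>)) \<and>
         \<not> (\<exists>f. chi_binding \<G> f \<and> special_linear f)"
proof (intro conjI)
  have G: "C5_blowup (G m) m fst" for m
    unfolding G_def by (rule C5_blowup_complete_expansion)
  have clique: "clique_number (G m) = 2 * m" for m
    by (rule C5_blowup_clique_number[OF G])
  show "\<forall>m\<ge>1. G m \<in> free_graphs {P3_union_P2, gem} \<and> clique_number (G m) = 2 * m \<and>
      int (chromatic_number (G m)) = \<lceil>5 * real (clique_number (G m)) / 4\<rceil>"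
    unfolding clique ceiling_five_quarters
    using C5_blowup_free[OF G] C5_blowup_chromatic_number[OF G] by simp
  have ge: "real ((5 * m + 1) div 2) \<le> f (2 * m)" if f: "chi_binding \<G> f" for f m
  proof -
    obtain G' :: "nat pair_pre_digraph" and \<pi> where G': "C5_blowup G' m \<pi>"
      using C5_blowup_nat_copy[OF G] by blast
    have "G' \<in> \<G>" unfolding \<G>_def by (rule C5_blowup_free[OF G'])
    then have "real (chromatic_number G') \<le> f (clique_number G')"
      using f by (simp add: chi_binding_def)
    then show ?thesis
      by (simp only: C5_blowup_chromatic_number[OF G'] C5_blowup_clique_number[OF G'])
  qed
  have bound: "chromatic_number H \<le> 2 ^ clique_number H * clique_number H" if "H \<in> \<G>" for H
  proof (rule chromatic_number_le_if_P3_union_P2_free)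
    have "pair_graph H \<and> (\<forall>F\<in>{P3_union_P2, gem}. \<forall>f. \<not> induced_copy F H f)"
      using that pair_graph_P3_union_P2 pair_graph_gem unfolding \<G>_def
      by (subst (asm) free_graphs_iff) auto
    then show "pair_graph H" "\<not> induced_copy P3_union_P2 H f" for f by auto
  qed
  have "\<exists>f. optimal_chi_binding \<G> f"
  proof (rule optimal_chi_binding_exists)
    show "\<exists>H\<in>\<G>. clique_number H = x" for x
      using complete_graph_free clique_number_complete_graph unfolding \<G>_def by blast
  qed (rule bound)
  then obtain f where f: "optimal_chi_binding \<G> f" by blast
  then have "chi_binding \<G> f" by (simp add: optimal_chi_binding_def)
  then have "\<forall>m\<ge>1. f (clique_number (G m)) \<ge> real_of_int \<lceil>5 * real (clique_number (G m)) / 4\<rceil>"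
    unfolding clique ceiling_five_quarters using ge by simp
  with f show "\<exists>f_opt. optimal_chi_binding \<G> f_opt \<and> (\<forall>m\<ge>1. f_opt (clique_number (G m))
      \<ge> real_of_int \<lceil>5 * real (clique_number (G m)) / 4\<rceil>)" by blast
  show "\<not> (\<exists>f. chi_binding \<G> f \<and> special_linear f)"
  proof safe
    fix f assume f: "chi_binding \<G> f" "special_linear f"
    then obtain c where c: "\<And>x. f x = real x + c" by (auto simp: special_linear_def)
    \<comment> \<open>At m = 2n the bound reads \<open>5 n \<le> 4 n + c\<close>.\<close>
    obtain n :: nat where n: "c < real n" using reals_Archimedean2 by blast
    have "real (5 * n) \<le> 4 * real n + c"
      using ge[OF f(1), of "2 * n"] c by simp
    then show False using n by simp
  qed
qed

end
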